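(* Let $d=5+4k+j$, where $j,k$ are integers with $0\le j\le 3$ and $k\ge 0$. Then every $(3;4,d)$-cage $G$ has at least $k$ bridges, and the order of $G$ is $n=14+2j+6k$.
   Context: All graphs are finite and simple. A $(3;4,d)$-graph is a $3$-regular graph of girth $4$ and diameter exactly $d$; a $(3;4,d)$-cage is a $(3;4,d)$-graph of smallest order. (Here $k$ is just a parameter in the expression of $d$, not the degree.) *)

theory Defs
  imports "Graph_Theory.Graph_Theory"
begin

text \<open>
  A finite simple graph is a \<^locale>\<open>pair_graph\<close>: a finite, loop-free digraph with symmetric arc
  relation and no parallel arcs. An undirected edge \<open>uv\<close> is the pair of arcs \<open>(u, v)\<close>, \<open>(v, u)\<close>.
\<close>

definition regular :: "nat \<Rightarrow> 'a pair_pre_digraph \<Rightarrow> bool" where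
  "regular r G \<longleftrightarrow> (\<forall>v \<in> pverts G. out_degree (with_proj G) v = r)"

text \<open>
  The library's cycles are directed, so the closed walk \<open>u, v, u\<close> along a single edge counts as a
  cycle. The cycles of the undirected graph are those of length at least 3.
\<close>

definition girth :: "'a pair_pre_digraph \<Rightarrow> enat" where
  "girth G = (INF p \<in> {p. pre_digraph.cycle (with_proj G) p \<and> 3 \<le> length p}. enat (length p))"

text \<open>
  \<open>\<mu>\<close> with unit weights is the usual distance; it is \<open>\<infinity>\<close> for vertices in different components, so
  a graph of finite diameter is connected.
\<close>

definition distance :: "'a pair_pre_digraph \<Rightarrow> 'a \<Rightarrow> 'a \<Rightarrow> ereal" where
  "distance G u v = wf_digraph.\<mu> (with_proj G) (\<lambda>_. 1) u v"

definition diameter :: "'a pair_pre_digraph \<Rightarrow> ereal" where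
  "diameter G = (SUP u \<in> pverts G. SUP v \<in> pverts G. distance G u v)"

definition del_edge :: "'a \<Rightarrow> 'a \<Rightarrow> 'a pair_pre_digraph \<Rightarrow> 'a pair_pre_digraph" where
  "del_edge u v G = G\<lparr>parcs := parcs G - {(u, v), (v, u)}\<rparr>"

text \<open>
  In a symmetric digraph the strongly connected components are the connected components. A bridge
  is an edge, taken here as an unordered pair, whose deletion increases their number.
\<close>

definition bridges :: "'a pair_pre_digraph \<Rightarrow> 'a set set" where
  "bridges G = {{u, v} | u v. (u, v) \<in> parcs G \<and>
     card (pre_digraph.sccs (with_proj G)) < card (pre_digraph.sccs (with_proj (del_edge u v G)))}"

definition rgd_graph :: "nat \<Rightarrow> nat \<Rightarrow> nat \<Rightarrow> 'a pair_pre_digraph \<Rightarrow> bool" where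
  "rgd_graph r g d G \<longleftrightarrow>
     pair_graph G \<and> regular r G \<and> girth G = enat g \<and> diameter G = ereal (real d)"

text \<open>
  The competitors in the minimality condition have natural numbers as vertices, whatever the vertex
  type of \<open>G\<close>: every finite graph has an isomorphic copy there.
\<close>

definition rgd_cage :: "nat \<Rightarrow> nat \<Rightarrow> nat \<Rightarrow> 'a pair_pre_digraph \<Rightarrow> bool" where
  "rgd_cage r g d G \<longleftrightarrow> rgd_graph r g d G \<and>
     (\<forall>H :: nat pair_pre_digraph. rgd_graph r g d H \<longrightarrow> card (pverts G) \<le> card (pverts H))"

end

theory Submission
  imports Defs
begin

text \<open>
  Lower bound: let \<open>N i\<close> be the number of vertices at distance at most \<open>i\<close> from an endpoint \<open>v\<close> of a
  diametral pair. Triangle-freeness gives \<open>N 2 \<ge> 7\<close>, and by parity of edge cuts \<open>N 4 \<ge> 10\<close> and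
  \<open>N 5 \<ge> 12\<close>. The neighbourhoods of the two ends of an edge are disjoint and lie in four consecutive
  layers, so \<open>N (i + 4) \<ge> N i + 6\<close>. Adding the seven vertices within distance 2 of the other endpoint,
  and using that the order is even, yields \<open>14 + 2 j + 6 k\<close>.

  Bridges: if the order is at most this number, the \<open>4 k + j\<close> middle layers have at most
  \<open>6 k + 2 j\<close> vertices, so at least \<open>2 k\<close> of them are singletons. Each singleton layer is incident
  with a bridge, and a bridge meets at most two layers.

  Upper bound: take two small graphs, each with one vertex (the root) of degree 2 and all others of
  degree 3, and connect their roots by a chain of \<open>k\<close> blocks with levels of sizes 1, 2, 2, 1.
\<close>

section \<open>Layers of a cubic triangle-free graph\<close>

definition ball :: "'a rel \<Rightarrow> 'a \<Rightarrow> nat \<Rightarrow> 'a set" where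
  "ball E v i = {u. \<exists>m\<le>i. (v, u) \<in> E ^^ m}"

definition layer :: "'a rel \<Rightarrow> 'a \<Rightarrow> nat \<Rightarrow> 'a set" where
  "layer E v i = {u. (v, u) \<in> E ^^ i \<and> (\<forall>m<i. (v, u) \<notin> E ^^ m)}"

lemma ball_0 [simp]: "ball E v 0 = {v}"
  by (auto simp: ball_def)

lemma layer_0 [simp]: "layer E v 0 = {v}"
  by (auto simp: layer_def)

lemma ball_mono: "i \<le> j \<Longrightarrow> ball E v i \<subseteq> ball E v j"
  unfolding ball_def using le_trans by blast

lemma center_in_ball [simp]: "v \<in> ball E v i"
  using ball_mono[of 0 i E v] by auto

lemma layer_subset_ball: "layer E v i \<subseteq> ball E v i"
  by (auto simp: layer_def ball_def)

lemma layer_Suc: "layer E v (Suc i) = ball E v (Suc i) - ball E v i"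
  unfolding layer_def ball_def by (auto simp: less_Suc_eq_le le_Suc_eq simp del: relpow.simps)

lemma ball_Suc: "ball E v (Suc i) = ball E v i \<union> layer E v (Suc i)"
  using ball_mono[of i "Suc i" E v] by (auto simp: layer_Suc)

lemma ball_step: "u \<in> ball E v i \<Longrightarrow> (u, w) \<in> E \<Longrightarrow> w \<in> ball E v (Suc i)"
  unfolding ball_def using relpow_Suc_I[of v u _ E w] Suc_le_mono by blast

lemma ball_trans: "u \<in> ball E v i \<Longrightarrow> w \<in> ball E u j \<Longrightarrow> w \<in> ball E v (i + j)"
  unfolding ball_def
proof clarify
  fix m m' assume "m \<le> i" "m' \<le> j" "(v, u) \<in> E ^^ m" "(u, w) \<in> E ^^ m'"
  then show "\<exists>l\<le>i + j. (v, w) \<in> E ^^ l"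
    by (intro exI[of _ "m + m'"]) (auto simp: relpow_add)
qed

text \<open>A shortest walk without its last step is again shortest: a quicker way to the
  penultimate vertex \<open>w\<close> would give a quicker way to \<open>u\<close>.\<close>

lemma layer_pred:
  assumes "u \<in> layer E v (Suc i)"
  obtains w where "w \<in> layer E v i" "(w, u) \<in> E"
proof -
  from assms obtain w where w: "(v, w) \<in> E ^^ i" "(w, u) \<in> E" by (auto simp: layer_def)
  moreover have "(v, w) \<notin> E ^^ m" if "m < i" for m
  proof
    assume "(v, w) \<in> E ^^ m"
    with w(2) have "(v, u) \<in> E ^^ Suc m" by auto
    with assms that show False unfolding layer_def by (auto simp del: relpow.simps)
  qed
  ultimately show thesis using that by (auto simp: layer_def)
qed

text \<open>A shortest walk into layer \<open>j\<close> passes through every earlier layer;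
  \<open>layer_pred\<close> is iterated backwards.\<close>

lemma layer_nonempty_mono:
  assumes "layer E v j \<noteq> {}" and "i \<le> j"
  shows "layer E v i \<noteq> {}"
  using assms
proof (induction "j - i" arbitrary: j)
  case (Suc n)
  then obtain j' where j: "j = Suc j'" "i \<le> j'" by (cases j) auto
  obtain u where "u \<in> layer E v (Suc j')" using Suc.prems(1) unfolding j(1) by blast
  then obtain w where "w \<in> layer E v j'" by (rule layer_pred)
  moreover have "n = j' - i" using Suc.hyps(2) j by simp
  ultimately show ?case using Suc.hyps(1)[of j'] j(2) by blast
qed (use le_antisym in auto)

lemma sym_relpow: "sym E \<Longrightarrow> (u, v) \<in> E ^^ m \<Longrightarrow> (v, u) \<in> E ^^ m"
proof (induction m arbitrary: v)
  case (Suc m)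
  then obtain w where "(u, w) \<in> E ^^ m" "(w, v) \<in> E" by auto
  with Suc have "(v, w) \<in> E" "(w, u) \<in> E ^^ m" by (auto dest: symD)
  then show ?case by (rule relpow_Suc_I2)
qed simp

lemma ball_commute: "sym E \<Longrightarrow> u \<in> ball E v i \<longleftrightarrow> v \<in> ball E u i"
  unfolding ball_def using sym_relpow[of E] by blast

lemma layer_commute: "sym E \<Longrightarrow> u \<in> layer E v i \<longleftrightarrow> v \<in> layer E u i"
  unfolding layer_def using sym_relpow[of E] by blast

text \<open>The pairs \<open>(a, b)\<close> and \<open>(b, a)\<close> are distinct and are removed
  together. This is the handshake argument behind all parity statements below.\<close>

lemma even_card_sym_irrefl:
  assumes "finite R" "sym R" "irrefl R"
  shows "even (card R)"
  using assms
proof (induction "card R" arbitrary: R rule: less_induct)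
  case less
  show ?case
  proof (cases "R = {}")
    case False
    then obtain a b where ab: "(a, b) \<in> R" by auto
    then have ba: "(b, a) \<in> R" "a \<noteq> b"
      using less.prems by (auto dest: symD simp: irrefl_def)
    let ?S = "R - {(a, b), (b, a)}"
    have c: "card R = card ?S + 2"
      using ab ba less.prems(1) card_mono[of R "{(a, b), (b, a)}"]
      by (subst card_Diff_subset) auto
    moreover have "sym ?S" "irrefl ?S"
      using less.prems by (auto simp: sym_def irrefl_def)
    ultimately have "even (card ?S)"
      using less.hyps[of ?S] less.prems(1) by simp
    with c show ?thesis by simp
  qed simp
qed

locale cubic_triangle_free =
  fixes V :: "'a set" and E :: "'a rel"
  assumes finite_V: "finite V"
    and E_subset: "E \<subseteq> V \<times> V"
    and sym_E: "sym E"
    and triangle_free: "\<And>x y z. (x, y) \<in> E \<Longrightarrow> (y, z) \<in> E \<Longrightarrow> (x, z) \<notin> E"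
    and degree: "\<And>x. x \<in> V \<Longrightarrow> card (E `` {x}) = 3"
begin

lemma E_commute: "(x, y) \<in> E \<longleftrightarrow> (y, x) \<in> E"
  using sym_E by (auto dest: symD)

lemma no_loop: "(x, x) \<notin> E"
  using triangle_free by blast

lemma finite_E: "finite E"
  using finite_subset[OF E_subset] finite_V by simp

lemma finite_nbrs [simp]: "finite (E `` S)"
  by (rule finite_subset[OF _ finite_V]) (use E_subset in auto)

lemma ball_subset_V: "v \<in> V \<Longrightarrow> ball E v i \<subseteq> V"
proof (induction i)
  case (Suc i)
  have "layer E v (Suc i) \<subseteq> V"
    using layer_pred[of _ E v i] E_subset by blast
  with Suc show ?case by (auto simp: ball_Suc)
qed simp

lemma finite_ball: "v \<in> V \<Longrightarrow> finite (ball E v i)"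
  using ball_subset_V finite_V finite_subset by blast

lemma finite_layer: "v \<in> V \<Longrightarrow> finite (layer E v i)"
  using finite_ball layer_subset_ball finite_subset by metis

lemma card_ball_Suc:
  "v \<in> V \<Longrightarrow> card (ball E v (Suc i)) = card (ball E v i) + card (layer E v (Suc i))"
  unfolding ball_Suc
  by (intro card_Un_disjoint finite_ball finite_layer) (auto simp: layer_Suc)

text \<open>The degrees in \<open>S\<close> sum to \<open>3 * card S\<close>, and the arcs inside
  \<open>S\<close> come in opposite pairs. So the number of arcs leaving \<open>S\<close> has the
  parity of \<open>card S\<close>.\<close>

lemma even_card_cut:
  assumes "S \<subseteq> V"
  shows "even (card (E \<inter> S \<times> - S) + card S)"
proof -
  have fin: "finite S" using assms finite_V finite_subset by blast
  have "card (E \<inter> S \<times> UNIV) = card (SIGMA x:S. E `` {x})"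
    by (rule arg_cong[of _ _ card]) auto
  also have "\<dots> = (\<Sum>x\<in>S. card (E `` {x}))"
    using fin by simp
  also have "\<dots> = 3 * card S"
    using assms degree by (simp add: subset_iff)
  finally have a: "card (E \<inter> S \<times> UNIV) = 3 * card S" .
  have b: "card (E \<inter> S \<times> UNIV) = card (E \<inter> S \<times> S) + card (E \<inter> S \<times> - S)"
    using finite_E by (subst card_Un_disjoint[symmetric]) (auto intro: arg_cong[of _ _ card])
  have "even (card (E \<inter> S \<times> S))"
    using sym_E finite_E no_loop by (intro even_card_sym_irrefl) (auto simp: sym_def irrefl_def)
  then have "even (card (E \<inter> S \<times> - S)) = even (3 * card S)"
    using a b by presburger
  then show ?thesis by simp
qed

lemma even_order: "even (card V)"
proof -
  have "E \<inter> V \<times> - V = {}" using E_subset by auto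
  then show ?thesis using even_card_cut[of V] by simp
qed

section \<open>Growth of balls\<close>

lemma nbr_not_in_ball: "u \<notin> ball E v (Suc i) \<Longrightarrow> (u, w) \<in> E \<Longrightarrow> w \<notin> ball E v i"
  using ball_step[of w E v i u] E_commute by blast

text \<open>A vertex of layer \<open>i + 2\<close> and its three neighbours lie in layers
  \<open>i + 1\<close> to \<open>i + 3\<close>.\<close>

lemma card_ball_add_3:
  assumes v: "v \<in> V" and ne: "layer E v (i + 2) \<noteq> {}"
  shows "card (ball E v i) + 4 \<le> card (ball E v (i + 3))"
proof -
  obtain x where x: "x \<in> ball E v (i + 2)" "x \<notin> ball E v (i + 1)"
    using ne by (auto simp: layer_Suc)
  have V: "x \<in> V" using x(1) ball_subset_V v by blast
  have xi: "x \<notin> ball E v i" using x(2) ball_mono[of i "i + 1" E v] by auto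
  have xj: "x \<in> ball E v (i + 3)" using x(1) ball_mono[of "i + 2" "i + 3" E v] by auto
  have "w \<notin> ball E v i \<and> w \<in> ball E v (i + 3)" if "(x, w) \<in> E" for w
    using that x nbr_not_in_ball[of x v i w] ball_step[of x E v "i + 2" w]
    by (simp add: numeral_3_eq_3)
  then have "ball E v i \<union> insert x (E `` {x}) \<subseteq> ball E v (i + 3)"
    and "ball E v i \<inter> insert x (E `` {x}) = {}"
    using xi xj ball_mono[of i "i + 3" E v] by auto
  then have "card (ball E v i) + card (insert x (E `` {x})) \<le> card (ball E v (i + 3))"
    using finite_ball[OF v] by (subst card_Un_disjoint[symmetric]) (auto intro!: card_mono)
  moreover have "card (insert x (E `` {x})) = 4"
    using degree[OF V] no_loop by (subst card_insert_disjoint) auto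
  ultimately show ?thesis by simp
qed

text \<open>An edge from layer \<open>i + 2\<close> to layer \<open>i + 3\<close> is chosen. The
  neighbourhoods of its ends lie in layers \<open>i + 1\<close> to \<open>i + 4\<close>, and a
  common neighbour would close a triangle, so they contribute six vertices.\<close>

lemma card_ball_add_4:
  assumes v: "v \<in> V" and ne: "layer E v (i + 3) \<noteq> {}"
  shows "card (ball E v i) + 6 \<le> card (ball E v (i + 4))"
proof -
  obtain y where y: "y \<in> layer E v (Suc (i + 2))" using ne by (auto simp: numeral_3_eq_3)
  then obtain x where x: "x \<in> layer E v (i + 2)" and xy: "(x, y) \<in> E" by (rule layer_pred)
  have xV: "x \<in> V" and yV: "y \<in> V" using xy E_subset by auto
  have x': "x \<in> ball E v (i + 2)" "x \<notin> ball E v (i + 1)" using x by (auto simp: layer_Suc)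
  have y': "y \<in> ball E v (i + 3)" "y \<notin> ball E v (i + 2)"
    using y by (auto simp: layer_Suc numeral_3_eq_3)
  have "w \<notin> ball E v i \<and> w \<in> ball E v (i + 4)" if "(x, w) \<in> E" for w
    using that x' nbr_not_in_ball[of x v i w] ball_step[of x E v "i + 2" w]
      ball_mono[of "i + 3" "i + 4" E v]
    by (auto simp: numeral_3_eq_3)
  moreover have "w \<notin> ball E v i \<and> w \<in> ball E v (i + 4)" if "(y, w) \<in> E" for w
    using that y' nbr_not_in_ball[of y v "i + 1" w] ball_step[of y E v "i + 3" w]
      ball_mono[of i "i + 1" E v]
    by (auto simp: eval_nat_numeral)
  ultimately have "ball E v i \<union> (E `` {x} \<union> E `` {y}) \<subseteq> ball E v (i + 4)"
    and "ball E v i \<inter> (E `` {x} \<union> E `` {y}) = {}"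
    using ball_mono[of i "i + 4" E v] by auto
  then have "card (ball E v i) + card (E `` {x} \<union> E `` {y}) \<le> card (ball E v (i + 4))"
    using finite_ball[OF v] by (subst card_Un_disjoint[symmetric]) (auto intro!: card_mono)
  moreover have "card (E `` {x} \<union> E `` {y}) = 6"
    using degree[OF xV] degree[OF yV] triangle_free[OF xy]
    by (subst card_Un_disjoint) auto
  ultimately show ?thesis by simp
qed

text \<open>The seven vertices are \<open>v\<close>, its three neighbours, a vertex \<open>r\<close>
  of layer 2, and two further neighbours of some \<open>a\<close> that is adjacent to
  \<open>v\<close> but not to \<open>r\<close>. A nonempty layer 3 excludes the complete bipartite
  graph on 3 + 3 vertices, whose balls of radius 2 have only six vertices.\<close>

lemma card_ball_2:
  assumes v: "v \<in> V" and ne: "layer E v 3 \<noteq> {}"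
  shows "7 \<le> card (ball E v 2)"
proof -
  obtain x where x: "x \<in> layer E v (Suc 2)" using ne by (auto simp: numeral_3_eq_3)
  then obtain r where r: "r \<in> layer E v (Suc 1)" and rx: "(r, x) \<in> E"
    by (auto elim: layer_pred simp: numeral_2_eq_2)
  have rV: "r \<in> V" using rx E_subset by auto
  have r': "r \<in> ball E v 2" "r \<notin> ball E v 1" using r by (auto simp: layer_Suc numeral_2_eq_2)
  have x': "x \<notin> ball E v 2" using x unfolding layer_Suc by blast
  have nbrs1: "E `` {v} \<subseteq> ball E v 1" using ball_step[of v E v 0] by auto
  \<comment> \<open>\<open>x\<close> is a neighbour of \<open>r\<close> at distance 3 from
    \<open>v\<close>, so it separates the two neighbourhoods; having equal size, neither contains
    the other.\<close>
  have "E `` {v} \<noteq> E `` {r}"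
    using rx x' nbrs1 ball_mono[of 1 2 E v] by auto
  then have "\<not> E `` {v} \<subseteq> E `` {r}"
    using degree[OF v] degree[OF rV] card_subset_eq[of "E `` {r}" "E `` {v}"] by auto
  then obtain a where a: "(v, a) \<in> E" "(a, r) \<notin> E" using E_commute by blast
  have aV: "a \<in> V" using a E_subset by auto
  have rv: "r \<notin> insert v (E `` {v})" using r' nbrs1 by auto
  have "E `` {a} \<inter> E `` {v} = {}" using triangle_free a(1) by blast
  moreover have "E `` {a} \<subseteq> ball E v 2"
    using ball_step[of a E v 1] a(1) nbrs1 by (auto simp: numeral_2_eq_2)
  ultimately have sub: "insert r (insert v (E `` {v})) \<union> (E `` {a} - {v}) \<subseteq> ball E v 2"
    and disj: "insert r (insert v (E `` {v})) \<inter> (E `` {a} - {v}) = {}"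
    using a(2) r' nbrs1 ball_mono[of 1 2 E v] by auto
  have "card (insert r (insert v (E `` {v}))) = 5"
    using rv no_loop degree[OF v] by simp
  moreover have "card (E `` {a} - {v}) = 2"
    using a(1) degree[OF aV] E_commute by simp
  ultimately have "card (insert r (insert v (E `` {v})) \<union> (E `` {a} - {v})) = 7"
    using disj by (subst card_Un_disjoint) auto
  then show ?thesis using card_mono[OF finite_ball[OF v] sub] by simp
qed

section \<open>Edge cuts between consecutive layers\<close>

definition layer_cut :: "'a \<Rightarrow> nat \<Rightarrow> 'a rel" where
  "layer_cut v i = E \<inter> ball E v i \<times> - ball E v i"

text \<open>An arc advances at most one layer, so an arc leaving a ball starts in its outermost
  layer. Only outward arcs are taken, so each edge of the cut counts once.\<close>

lemma layer_cut_subset_layers: "layer_cut v i \<subseteq> layer E v i \<times> layer E v (Suc i)"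
proof (rule subrelI)
  fix x y assume xy: "(x, y) \<in> layer_cut v i"
  then have "y \<in> layer E v (Suc i)"
    using ball_step[of x E v i y] by (auto simp: layer_cut_def layer_Suc)
  moreover have "x \<in> layer E v i"
  proof (cases i)
    case (Suc i')
    then show ?thesis using xy ball_step[of x E v i' y] by (auto simp: layer_cut_def layer_Suc)
  qed (use xy in \<open>auto simp: layer_cut_def\<close>)
  ultimately show "(x, y) \<in> layer E v i \<times> layer E v (Suc i)" by blast
qed

lemma finite_layer_cut: "finite (layer_cut v i)"
  using finite_E by (auto simp: layer_cut_def)

lemma layer_cut_nonempty: "layer E v (Suc i) \<noteq> {} \<Longrightarrow> layer_cut v i \<noteq> {}"
proof -
  assume "layer E v (Suc i) \<noteq> {}"
  then obtain x where x: "x \<in> layer E v (Suc i)" by blast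
  then obtain w where "w \<in> layer E v i" "(w, x) \<in> E" by (rule layer_pred)
  then have "(w, x) \<in> layer_cut v i"
    using x layer_subset_ball[of E v i] by (auto simp: layer_cut_def layer_Suc)
  then show ?thesis by blast
qed

lemma even_layer_cut: "v \<in> V \<Longrightarrow> even (card (layer_cut v i)) = even (card (ball E v i))"
  using even_card_cut[OF ball_subset_V, of v i] by (simp add: layer_cut_def)

text \<open>Every edge of the two cuts ends at \<open>x\<close>, and \<open>x\<close> has no
  neighbour in its own layer, so the cuts share out the three edges at \<open>x\<close>.\<close>

lemma card_cuts_singleton:
  assumes v: "v \<in> V" and s: "layer E v (Suc i) = {x}"
  shows "card (layer_cut v i) + card (layer_cut v (Suc i)) = 3"
proof -
  have xV: "x \<in> V" using s layer_subset_ball[of E v "Suc i"] ball_subset_V[OF v] by blast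
  have "card (layer_cut v i) = card ((\<lambda>w. (w, x)) ` (E `` {x} \<inter> ball E v i))"
    using layer_cut_subset_layers[of v i] s E_commute
    by (intro arg_cong[of _ _ card]) (auto simp: layer_cut_def layer_Suc)
  also have "\<dots> = card (E `` {x} \<inter> ball E v i)"
    by (rule card_image) (auto simp: inj_on_def)
  finally have a: "card (layer_cut v i) = card (E `` {x} \<inter> ball E v i)" .
  have "ball E v (Suc i) = insert x (ball E v i)" using s by (simp add: ball_Suc)
  then have "layer_cut v (Suc i) = (\<lambda>w. (x, w)) ` (E `` {x} - ball E v i)"
    using layer_cut_subset_layers[of v "Suc i"] s no_loop by (fastforce simp: layer_cut_def)
  then have "card (layer_cut v (Suc i)) = card ((\<lambda>w. (x, w)) ` (E `` {x} - ball E v i))"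
    by simp
  also have "\<dots> = card (E `` {x} - ball E v i)"
    by (rule card_image) (auto simp: inj_on_def)
  finally have b: "card (layer_cut v (Suc i)) = card (E `` {x} - ball E v i)" .
  have "E `` {x} = (E `` {x} \<inter> ball E v i) \<union> (E `` {x} - ball E v i)" by blast
  then have "card (E `` {x}) = card (E `` {x} \<inter> ball E v i) + card (E `` {x} - ball E v i)"
    by (metis Int_Diff_disjoint card_Un_disjoint finite_Diff finite_Int finite_nbrs)
  then show ?thesis using a b degree[OF xV] by simp
qed

text \<open>Two consecutive singleton layers are joined by one edge, which leaves two edges of the
  first singleton for the cut before it. The ball inside that cut has the same parity.\<close>

lemma even_ball_before_two_singletons:
  assumes v: "v \<in> V" and s: "card (layer E v (Suc i)) = 1" "card (layer E v (Suc (Suc i))) = 1"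
  shows "even (card (ball E v i))"
proof -
  obtain x y where xy: "layer E v (Suc i) = {x}" "layer E v (Suc (Suc i)) = {y}"
    using s by (auto simp: card_1_singleton_iff)
  have "layer_cut v (Suc i) = {(x, y)}"
    using layer_cut_subset_layers[of v "Suc i"] layer_cut_nonempty[of v "Suc i"] xy by auto
  with card_cuts_singleton[OF v xy(1)] have "card (layer_cut v i) = 2" by simp
  then show ?thesis using even_layer_cut[OF v, of i] by simp
qed

text \<open>Each of the two middle vertices \<open>a\<close>, \<open>b\<close> is adjacent to
  \<open>x\<close>. For \<open>a\<close> to reach degree 3 it must also be adjacent to
  \<open>b\<close>, which closes a triangle.\<close>

lemma no_layer_sizes_1_2_1:
  assumes v: "v \<in> V" and "card (layer E v (Suc i)) = 1"
    and "card (layer E v (Suc (Suc i))) = 2" and "card (layer E v (Suc (Suc (Suc i)))) = 1"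
  shows False
proof -
  obtain x y where xy: "layer E v (Suc i) = {x}" "layer E v (Suc (Suc (Suc i))) = {y}"
    using assms by (auto simp: card_1_singleton_iff)
  obtain a b where ab: "layer E v (Suc (Suc i)) = {a, b}" "a \<noteq> b"
    using assms by (auto simp: card_2_iff)
  have nx: "(x, z) \<in> E" if "z \<in> {a, b}" for z
    using layer_pred[of z E v "Suc i"] that ab xy by auto
  have "E `` {z} \<subseteq> {x, a, b, y}" if "z \<in> {a, b}" for z
  proof
    fix w assume "w \<in> E `` {z}"
    then have zw: "(z, w) \<in> E" by simp
    have "z \<in> ball E v (Suc (Suc i))" "z \<notin> ball E v (Suc i)"
      using that ab by (auto simp: layer_Suc)
    then have "w \<in> ball E v (Suc (Suc (Suc i)))" "w \<notin> ball E v i"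
      using zw ball_step nbr_not_in_ball by metis+
    then show "w \<in> {x, a, b, y}"
      using xy ab(1) by (auto simp: layer_Suc)
  qed
  then have sub: "E `` {a} \<subseteq> {x, b, y}" using no_loop by fastforce
  have "a \<in> V" using nx E_subset by auto
  then have "E `` {a} = {x, b, y}"
    using degree[of a] by (intro card_seteq sub) (auto simp: card_insert_if)
  then have "(a, b) \<in> E" by blast
  then show False using nx triangle_free by blast
qed

section \<open>Lower bounds for balls and for the order\<close>

lemma card_layer_pos: "v \<in> V \<Longrightarrow> layer E v i \<noteq> {} \<Longrightarrow> 1 \<le> card (layer E v i)"
  using finite_layer[of v i] by (simp add: Suc_le_eq card_gt_0_iff)

text \<open>The trivial count is 7 + 1 + 1. Equality would need two singleton layers behind a ball
  of odd size, against \<open>even_ball_before_two_singletons\<close>.\<close>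

lemma card_ball_4:
  assumes v: "v \<in> V" and ne: "layer E v 4 \<noteq> {}"
  shows "10 \<le> card (ball E v 4)"
proof -
  have ne: "layer E v i \<noteq> {}" if "i \<le> 4" for i
    using layer_nonempty_mono[OF ne that] .
  have "7 \<le> card (ball E v 2)" using card_ball_2[OF v ne] by simp
  moreover have "1 \<le> card (layer E v 3)" "1 \<le> card (layer E v 4)"
    using card_layer_pos[OF v] ne by auto
  moreover have "card (ball E v 4) = card (ball E v 2) + card (layer E v 3) + card (layer E v 4)"
    using card_ball_Suc[OF v, of 3] card_ball_Suc[OF v, of 2] by (simp add: eval_nat_numeral)
  moreover have "even (card (ball E v 2))" if "card (layer E v 3) = 1" "card (layer E v 4) = 1"
    using even_ball_before_two_singletons[OF v, of 2] that by (simp add: eval_nat_numeral)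
  ultimately show ?thesis by presburger
qed

lemma card_ball_5:
  assumes v: "v \<in> V" and ne: "layer E v 5 \<noteq> {}"
  shows "12 \<le> card (ball E v 5)"
proof -
  have ne: "layer E v i \<noteq> {}" if "i \<le> 5" for i
    using layer_nonempty_mono[OF ne that] .
  let ?n = "\<lambda>i. card (layer E v i)"
  have b2: "7 \<le> card (ball E v 2)" using card_ball_2[OF v ne] by simp
  have pos: "1 \<le> ?n 3" "1 \<le> ?n 4" "1 \<le> ?n 5"
    using card_layer_pos[OF v] ne by auto
  have b3: "card (ball E v 3) = card (ball E v 2) + ?n 3"
    and b5: "card (ball E v 5) = card (ball E v 2) + ?n 3 + ?n 4 + ?n 5"
    using card_ball_Suc[OF v, of 4] card_ball_Suc[OF v, of 3] card_ball_Suc[OF v, of 2]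
    by (simp_all add: eval_nat_numeral)
  have s4: "card (ball E v 2) + 4 \<le> card (ball E v 5)"
    using card_ball_add_3[OF v, of 2] ne[of 4] by simp
  have e2: "even (card (ball E v 2))" if "?n 3 = 1" "?n 4 = 1"
    using even_ball_before_two_singletons[OF v, of 2] that by (simp add: eval_nat_numeral)
  have e3: "even (card (ball E v 3))" if "?n 4 = 1" "?n 5 = 1"
    using even_ball_before_two_singletons[OF v, of 3] that by (simp add: eval_nat_numeral)
  have m: "\<not> (?n 3 = 1 \<and> ?n 4 = 2 \<and> ?n 5 = 1)"
    using no_layer_sizes_1_2_1[OF v, of 2] by (auto simp: eval_nat_numeral)
  show ?thesis
  proof (rule ccontr)
    assume "\<not> ?thesis"
    \<comment> \<open>With fewer than 12 vertices, \<open>card_ball_add_3\<close> leaves exactly 7 +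
      4. The splittings 1, 1, 2 and 2, 1, 1 fail by parity, and 1, 2, 1 by the excluded
      pattern.\<close>
    then have seven: "card (ball E v 2) = 7" and sum: "?n 3 + ?n 4 + ?n 5 = 4"
      using b2 b5 s4 by auto
    have "?n 3 = 1 \<and> ?n 4 = 1 \<or> ?n 4 = 1 \<and> ?n 5 = 1 \<and> ?n 3 = 2 \<or> ?n 3 = 1 \<and> ?n 4 = 2 \<and> ?n 5 = 1"
      using sum pos by linarith
    then show False using seven e2 e3 m b3 by auto
  qed
qed

text \<open>For \<open>k = 0\<close> the bounds on the balls of radius 2, 3, 4, 5 are 7, 8, 10, 12,
  which for positive \<open>j\<close> is one below \<open>7 + 2 * j\<close>. Parity of the order
  makes up for this unit later. Each increase of \<open>k\<close> adds four layers and six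
  vertices.\<close>

lemma card_ball_lower_bound:
  assumes v: "v \<in> V" and "layer E v (3 + 4 * k + j) \<noteq> {}" and "j \<le> 3"
  shows "7 + 6 * k + 2 * j \<le> card (ball E v (2 + 4 * k + j)) + (if j = 0 then 0 else 1)"
  using assms(2)
proof (induction k)
  case 0
  have ne: "layer E v i \<noteq> {}" if "i \<le> 3 + j" for i
    using layer_nonempty_mono[of E v _ i] 0 that by auto
  have b2: "7 \<le> card (ball E v 2)" using card_ball_2[OF v ne] by simp
  from \<open>j \<le> 3\<close> consider "j = 0" | "j = 1" | "j = 2" | "j = 3" by linarith
  then show ?case
  proof cases
    case 2
    then show ?thesis
      using b2 card_ball_Suc[OF v, of 2] card_layer_pos[OF v ne, of 3]
      by (simp add: eval_nat_numeral)
  next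
    case 3
    then show ?thesis using card_ball_4[OF v ne] by simp
  next
    case 4
    then show ?thesis using card_ball_5[OF v ne] by simp
  qed (use b2 in simp)
next
  case (Suc k)
  have ne: "layer E v i \<noteq> {}" if "i \<le> 7 + 4 * k + j" for i
    using layer_nonempty_mono[of E v _ i] Suc.prems that by auto
  show ?case
    using Suc.IH ne[of "3 + 4 * k + j"] card_ball_add_4[OF v, of "2 + 4 * k + j"] ne[of "2 + 4 * k + j + 3"]
    by (simp add: algebra_simps)
qed

text \<open>The ball of radius \<open>d - 3\<close> about \<open>v\<close> misses the ball of radius
  2 about \<open>w\<close>, since a common vertex would bring \<open>w\<close> within distance
  \<open>d - 1\<close> of \<open>v\<close>.\<close>

lemma order_ge_two_ends:
  assumes v: "v \<in> V" and ne: "layer E v d \<noteq> {}" and "3 \<le> d"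
  shows "card (ball E v (d - 3)) + 7 \<le> card V"
proof -
  obtain w where w: "w \<in> layer E v d" using ne by auto
  then have wV: "w \<in> V" using layer_subset_ball[of E v d] ball_subset_V[OF v] by blast
  have "v \<in> layer E w d" using w layer_commute[OF sym_E] by metis
  then have "layer E w 3 \<noteq> {}" using layer_nonempty_mono \<open>3 \<le> d\<close> by fastforce
  then have seven: "7 \<le> card (ball E w 2)" using card_ball_2[OF wV] by blast
  have "w \<notin> ball E v (d - 1)"
    using w layer_Suc[of E v "d - 1"] \<open>3 \<le> d\<close> by auto
  moreover have "d - 3 + 2 = d - 1" using \<open>3 \<le> d\<close> by simp
  ultimately have "ball E v (d - 3) \<inter> ball E w 2 = {}"
    using ball_trans[of _ E v "d - 3" w 2] ball_commute[OF sym_E, of w] by auto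
  then have "card (ball E v (d - 3)) + card (ball E w 2) = card (ball E v (d - 3) \<union> ball E w 2)"
    using finite_ball v wV by (intro card_Un_disjoint[symmetric])
  also have "\<dots> \<le> card V"
    using ball_subset_V v wV finite_V by (intro card_mono) auto
  finally have "card (ball E v (d - 3)) + card (ball E w 2) \<le> card V" .
  with seven show ?thesis by simp
qed

lemma order_lower_bound:
  assumes v: "v \<in> V" and ne: "layer E v (5 + 4 * k + j) \<noteq> {}" and "j \<le> 3"
  shows "14 + 2 * j + 6 * k \<le> card V"
proof -
  have "layer E v (3 + 4 * k + j) \<noteq> {}"
    using layer_nonempty_mono[OF ne] by simp
  from card_ball_lower_bound[OF v this \<open>j \<le> 3\<close>]
  have "14 + 2 * j + 6 * k \<le> card V + 1"
    using order_ge_two_ends[OF v ne] by (auto split: if_splits)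
  \<comment> \<open>The only value left below the target is the target minus one, which is
    odd.\<close>
  moreover have "card V + 1 \<noteq> 14 + 2 * j + 6 * k"
    using even_order by presburger
  ultimately show ?thesis by simp
qed

lemma many_single_edge_cuts:
  assumes v: "v \<in> V" and ne: "layer E v d \<noteq> {}" and d: "d = 5 + 4 * k + j"
    and order: "card V \<le> 14 + 2 * j + 6 * k"
  shows "k \<le> card {i. i < d \<and> card (layer_cut v i) = 1}"
proof -
  let ?n = "\<lambda>i. card (layer E v i)"
  have ne: "layer E v i \<noteq> {}" if "i \<le> d" for i using layer_nonempty_mono[OF ne that] .
  \<comment> \<open>The \<open>m\<close> middle layers have indices 3 to \<open>d - 3\<close>; they
    avoid the balls of radius 2 about both ends.\<close>
  define m where "m = 4 * k + j"
  define Z where "Z = {i\<in>{3..<3 + m}. ?n i = 1}"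
  have "card (ball E v (2 + t)) = card (ball E v 2) + (\<Sum>i = 3..<3 + t. ?n i)" for t
    by (induction t) (auto simp: card_ball_Suc[OF v] numeral_3_eq_3)
  from this[of m] have "card (ball E v (2 + m)) = card (ball E v 2) + (\<Sum>i = 3..<3 + m. ?n i)" .
  moreover have "7 \<le> card (ball E v 2)" using card_ball_2[OF v ne] d by simp
  moreover have "card (ball E v (2 + m)) + 7 \<le> card V"
    using order_ge_two_ends[OF v ne, of d] d by (simp add: m_def)
  ultimately have "7 + (\<Sum>i\<in>{3..<3 + m}. ?n i) + 7 \<le> card V"
    by linarith
  with order have sum: "(\<Sum>i\<in>{3..<3 + m}. ?n i) \<le> 2 * j + 6 * k" by simp
  \<comment> \<open>Every middle layer outside \<open>Z\<close> has at least two vertices and those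
    in \<open>Z\<close> have one, so \<open>2 * m\<close> is at most their total size plus
    \<open>card Z\<close>.\<close>
  have "2 * m = (\<Sum>i\<in>{3..<3 + m}. 2::nat)" by simp
  also have "\<dots> \<le> (\<Sum>i\<in>{3..<3 + m}. ?n i + (if i \<in> Z then 1 else 0))"
  proof (rule sum_mono)
    fix i assume i: "i \<in> {3..<3 + m}"
    then have "1 \<le> ?n i" using card_layer_pos[OF v ne] d by (simp add: m_def)
    then show "2 \<le> ?n i + (if i \<in> Z then 1 else 0)" using i by (auto simp: Z_def)
  qed
  also have "\<dots> = (\<Sum>i\<in>{3..<3 + m}. ?n i) + card Z"
    by (simp add: sum.distrib sum.If_cases Z_def Int_def)
  finally have Z: "2 * k \<le> card Z" using sum by (simp add: m_def)
  let ?K = "{i. i < d \<and> card (layer_cut v i) = 1}"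
  \<comment> \<open>The three edges at a singleton layer split into two nonempty cuts, one of which
    is a single edge. It lies after the layer (index in \<open>?K\<close>) or before it (index in
    the shifted set).\<close>
  have "Z \<subseteq> ?K \<union> Suc ` ?K"
  proof
    fix i assume "i \<in> Z"
    then obtain i' where i: "i = Suc i'" "Suc i < d" and s: "?n (Suc i') = 1"
      using d by (cases i) (auto simp: Z_def m_def)
    then obtain x where "layer E v (Suc i') = {x}" by (auto simp: card_1_singleton_iff)
    then have "card (layer_cut v i') + card (layer_cut v i) = 3" using card_cuts_singleton[OF v] i by simp
    moreover have "layer_cut v i' \<noteq> {}" "layer_cut v i \<noteq> {}"
      using layer_cut_nonempty ne i by auto
    then have "card (layer_cut v i') \<ge> 1" "card (layer_cut v i) \<ge> 1"
      using finite_layer_cut by (auto simp: Suc_le_eq card_gt_0_iff)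
    ultimately have "card (layer_cut v i') = 1 \<or> card (layer_cut v i) = 1" by linarith
    then show "i \<in> ?K \<union> Suc ` ?K" using i by auto
  qed
  then have "card Z \<le> card (?K \<union> Suc ` ?K)" by (intro card_mono) auto
  also have "\<dots> \<le> card ?K + card ?K"
    by (rule order_trans[OF card_Un_le]) (simp add: card_image)
  finally show ?thesis using Z by simp
qed

end

section \<open>Distance, girth and bridges in terms of the arc relation\<close>

context pair_wf_digraph
begin

text \<open>This links the walks of the library to relational powers. \<open>u\<close> must be a
  vertex: the empty walk requires one, whereas the zeroth power relates everything to
  itself.\<close>

lemma relpow_iff_awalk:
  assumes "u \<in> pverts G"
  shows "(u, v) \<in> parcs G ^^ m \<longleftrightarrow> (\<exists>p. awalk u p v \<and> length p = m)"
  using assms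
proof (induction m arbitrary: u)
  case 0
  then show ?case by (auto simp: awalk_Nil_iff)
next
  case (Suc m)
  have "(u, v) \<in> parcs G ^^ Suc m \<longleftrightarrow> (\<exists>w. (u, w) \<in> parcs G \<and> (w, v) \<in> parcs G ^^ m)"
    by (auto simp: relpow_commute simp del: relpow.simps dest: relpow_Suc_D2 intro: relpow_Suc_I2)
  also have "\<dots> \<longleftrightarrow> (\<exists>w. (u, w) \<in> parcs G \<and> (\<exists>p. awalk w p v \<and> length p = m))"
    using Suc.IH in_arcsD2 by blast
  also have "\<dots> \<longleftrightarrow> (\<exists>p. awalk u p v \<and> length p = Suc m)"
    unfolding length_Suc_conv
  proof safe
    fix w p assume "(u, w) \<in> parcs G" "awalk w p v" "m = length p"
    then show "\<exists>q. awalk u q v \<and> (\<exists>e ys. q = e # ys \<and> length ys = length p)"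
      by (intro exI[of _ "(u, w) # p"]) (simp add: awalk_Cons_iff)
  next
    fix a b ys assume "awalk u ((a, b) # ys) v" "m = length ys"
    then show "\<exists>w. (u, w) \<in> parcs G \<and> (\<exists>p. awalk w p v \<and> length p = length ys)"
      by (intro exI[of _ b]) (auto simp: awalk_Cons_iff)
  qed
  finally show ?case .
qed

lemma distance_le:
  assumes u: "u \<in> pverts G" and v: "v \<in> ball (parcs G) u m"
  shows "distance G u v \<le> ereal (real m)"
proof -
  from v obtain l where "l \<le> m" "(u, v) \<in> parcs G ^^ l" by (auto simp: ball_def)
  then obtain p where p: "awalk u p v" "length p \<le> m"
    by (metis relpow_iff_awalk[OF u])
  have "distance G u v \<le> ereal (awalk_cost (\<lambda>_. 1) p)"
    unfolding distance_def using p(1) by (rule min_cost_le_walk_cost)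
  also have "\<dots> \<le> ereal (real m)"
    using p(2) by (simp add: awalk_cost_def sum_list_triv)
  finally show ?thesis .
qed

text \<open>This also covers unreachable \<open>v\<close>, where the infimum over no walks is
  infinite.\<close>

lemma distance_ge:
  assumes u: "u \<in> pverts G" and v: "v \<notin> ball (parcs G) u m"
  shows "ereal (real (Suc m)) \<le> distance G u v"
  unfolding distance_def \<mu>_def
proof (rule INF_greatest)
  fix p assume "p \<in> {p. awalk u p v}"
  then have "(u, v) \<in> parcs G ^^ length p" by (metis relpow_iff_awalk[OF u] mem_Collect_eq)
  then have "Suc m \<le> length p" using v by (auto simp: ball_def not_less_eq_eq)
  then show "ereal (real (Suc m)) \<le> ereal (awalk_cost (\<lambda>_. 1) p)"
    by (simp add: awalk_cost_def sum_list_triv)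
qed

text \<open>From here on, diameter means membership in balls: \<open>d\<close> steps always suffice
  and \<open>d - 1\<close> do not. Positivity of \<open>d\<close> keeps \<open>d - 1\<close> from
  truncating.\<close>

lemma diameter_eq_iff:
  assumes "0 < d"
  shows "diameter G = ereal (real d) \<longleftrightarrow>
    (\<forall>u\<in>pverts G. \<forall>v\<in>pverts G. v \<in> ball (parcs G) u d) \<and>
    (\<exists>u\<in>pverts G. \<exists>v\<in>pverts G. v \<notin> ball (parcs G) u (d - 1))"
    (is "?D \<longleftrightarrow> ?A \<and> ?B")
proof
  assume D: ?D
  have le: "distance G u v \<le> ereal (real d)" if "u \<in> pverts G" "v \<in> pverts G" for u v
    unfolding D[symmetric] diameter_def using that by (blast intro: SUP_upper2)
  have ?A
  proof (intro ballI, rule ccontr)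
    fix u v assume "u \<in> pverts G" "v \<in> pverts G" "v \<notin> ball (parcs G) u d"
    then have "ereal (real (Suc d)) \<le> ereal (real d)"
      using distance_ge le order_trans by blast
    then show False by simp
  qed
  moreover have ?B
  proof (rule ccontr)
    assume "\<not> ?B"
    then have "diameter G \<le> ereal (real (d - 1))"
      unfolding diameter_def by (intro SUP_least distance_le) auto
    then show False using D \<open>0 < d\<close> by simp
  qed
  ultimately show "?A \<and> ?B" ..
next
  assume AB: "?A \<and> ?B"
  show ?D
  proof (rule antisym)
    show "diameter G \<le> ereal (real d)"
      unfolding diameter_def using AB by (intro SUP_least distance_le) auto
    obtain u v where uv: "u \<in> pverts G" "v \<in> pverts G" "v \<notin> ball (parcs G) u (d - 1)"
      using AB by blast
    then have "ereal (real d) \<le> distance G u v"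
      using distance_ge[of u v "d - 1"] \<open>0 < d\<close> by simp
    also have "\<dots> \<le> diameter G"
      unfolding diameter_def using uv by (blast intro: SUP_upper2 SUP_upper)
    finally show "ereal (real d) \<le> diameter G" .
  qed
qed

lemma regular_iff: "regular r G \<longleftrightarrow> (\<forall>v\<in>pverts G. card (parcs G `` {v}) = r)"
proof -
  have "out_degree (with_proj G) v = card (parcs G `` {v})" for v
  proof -
    have "out_arcs (with_proj G) v = Pair v ` (parcs G `` {v})"
      by (auto simp: out_arcs_def)
    then show ?thesis by (simp add: out_degree_def card_image inj_on_def)
  qed
  then show ?thesis by (simp add: regular_def)
qed

end

context pair_graph
begin

lemma cycle_of_triangle:
  assumes "(x, y) \<in> parcs G" "(y, z) \<in> parcs G" "(z, x) \<in> parcs G"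
  shows "cycle [(x, y), (y, z), (z, x)]"
  using assms in_arcsD1 no_loops'
  unfolding cycle_def awalk_def by (intro exI[of _ x]) auto

lemma no_triangle_if_girth:
  assumes "girth G = 4" "(x, y) \<in> parcs G" "(y, z) \<in> parcs G"
  shows "(x, z) \<notin> parcs G"
proof
  assume "(x, z) \<in> parcs G"
  then have "cycle [(x, y), (y, z), (z, x)]"
    using cycle_of_triangle assms(2,3) arcs_symmetric by blast
  then have "girth G \<le> enat (length [(x, y), (y, z), (z, x)])"
    unfolding girth_def by (intro INF_lower) simp
  with assms(1) show False by (simp add: numeral_eq_enat)
qed

lemma girth_eq_4:
  assumes tri: "\<And>x y z. (x, y) \<in> parcs G \<Longrightarrow> (y, z) \<in> parcs G \<Longrightarrow> (x, z) \<notin> parcs G"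
    and cyc: "(a, b) \<in> parcs G" "(b, c) \<in> parcs G" "(c, d) \<in> parcs G" "(d, a) \<in> parcs G"
    and ne: "a \<noteq> c" "b \<noteq> d"
  shows "girth G = 4"
proof (rule antisym)
  have "cycle [(a, b), (b, c), (c, d), (d, a)]"
    using cyc ne in_arcsD1 no_loops' unfolding cycle_def awalk_def by (intro exI[of _ a]) auto
  then have "girth G \<le> enat (length [(a, b), (b, c), (c, d), (d, a)])"
    unfolding girth_def by (intro INF_lower) simp
  then show "girth G \<le> 4" by (simp add: numeral_eq_enat eval_nat_numeral)
  show "4 \<le> girth G"
    unfolding girth_def
  proof (rule INF_greatest, clarify)
    fix p assume p: "cycle p" "3 \<le> length p"
    have "length p \<noteq> 3"
    proof
      assume "length p = 3"
      then obtain e1 e2 e3 where p3: "p = [e1, e2, e3]"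
        by (auto simp: numeral_3_eq_3 length_Suc_conv)
      obtain x y z where "(x, y) \<in> parcs G" "(y, z) \<in> parcs G" "(z, x) \<in> parcs G"
        using p(1) unfolding p3 cycle_def awalk_def by (cases e1; cases e2; cases e3) auto
      then show False using tri arcs_symmetric by blast
    qed
    then show "4 \<le> enat (length p)" using p(2) by (simp add: numeral_eq_enat)
  qed
qed

text \<open>Without the edge nothing leads out of \<open>S\<close>, so \<open>y\<close> is no longer
  reachable from \<open>x\<close>. The one component of the connected graph becomes at least
  two.\<close>

lemma bridge_if_single_arc_cut:
  assumes conn: "\<And>u v. u \<in> pverts G \<Longrightarrow> v \<in> pverts G \<Longrightarrow> u \<rightarrow>\<^sup>*\<^bsub>with_proj G\<^esub> v"
    and cut: "parcs G \<inter> S \<times> - S = {(x, y)}"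
  shows "{x, y} \<in> bridges G"
proof -
  have xy: "(x, y) \<in> parcs G" "x \<in> S" "y \<notin> S" using cut by auto
  have V: "x \<in> pverts G" "y \<in> pverts G" using xy in_arcsD1 in_arcsD2 by auto
  let ?H = "del_edge x y G"
  interpret H: pair_fin_digraph ?H
    using in_arcsD1 in_arcsD2 pair_finite_verts pair_finite_arcs
    by unfold_locales (auto simp: del_edge_def)
  have "strongly_connected (with_proj G)"
    using V(1) conn by (auto simp: strongly_connected_def)
  then have one: "card sccs = 1"
    using strongly_connected_eq_iff by simp
  have reach: "b \<in> S" if "a \<rightarrow>\<^sup>*\<^bsub>with_proj ?H\<^esub> b" "a \<in> S" for a b
    using that
  proof (induction rule: H.reachable_induct)
    case (step b c)
    then have "(b, c) \<in> parcs G" "(b, c) \<noteq> (x, y)" by (auto simp: del_edge_def)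
    then show ?case using cut step by blast
  qed
  have "H.scc_of x \<noteq> H.scc_of y"
  proof
    assume "H.scc_of x = H.scc_of y"
    then have "y \<in> H.scc_of x"
      using V H.in_scc_of_self[of y] by (simp add: del_edge_def)
    then have "x \<rightarrow>\<^sup>*\<^bsub>with_proj ?H\<^esub> y"
      by (simp add: H.scc_of_def)
    then show False using reach xy by blast
  qed
  then have two: "card {H.scc_of x, H.scc_of y} = 2" by simp
  have "x \<in> pverts ?H" "y \<in> pverts ?H" using V by (simp_all add: del_edge_def)
  then have "{H.scc_of x, H.scc_of y} \<subseteq> H.sccs_verts"
    using H.scc_of_in_sccs_verts by blast
  then have "card {H.scc_of x, H.scc_of y} \<le> card H.sccs"
    using H.finite_sccs_verts H.card_sccs_verts card_mono by metis
  with one two have "card sccs < card H.sccs" by simp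
  then show ?thesis using xy unfolding bridges_def by blast
qed

lemma finite_bridges: "finite (bridges G)"
  by (rule finite_subset[of _ "Pow (pverts G)"])
    (use in_arcsD1 in_arcsD2 pair_finite_verts in \<open>auto simp: bridges_def\<close>)

end

lemma cubic_triangle_free_if_rgd:
  assumes "rgd_graph 3 4 d G"
  shows "cubic_triangle_free (pverts G) (parcs G)"
proof -
  interpret pair_graph G using assms by (simp add: rgd_graph_def)
  show ?thesis
  proof
    show "finite (pverts G)" by (rule pair_finite_verts)
    show "parcs G \<subseteq> pverts G \<times> pverts G" using in_arcsD1 in_arcsD2 by auto
    show "sym (parcs G)" using arcs_symmetric by (auto simp: sym_def)
    show "(x, z) \<notin> parcs G" if "(x, y) \<in> parcs G" "(y, z) \<in> parcs G" for x y z
      using no_triangle_if_girth[OF _ that] assms by (simp add: rgd_graph_def numeral_eq_enat)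
    show "card (parcs G `` {x}) = 3" if "x \<in> pverts G" for x
      using assms that regular_iff by (auto simp: rgd_graph_def)
  qed
qed

lemma rgd_endpoint:
  assumes "rgd_graph r g d G" and "0 < d"
  obtains v where "v \<in> pverts G" "layer (parcs G) v d \<noteq> {}"
proof -
  interpret pair_graph G using assms by (simp add: rgd_graph_def)
  have "diameter G = ereal (real d)" using assms by (simp add: rgd_graph_def)
  then obtain v w where "v \<in> pverts G" "w \<in> ball (parcs G) v d" "w \<notin> ball (parcs G) v (d - 1)"
    using diameter_eq_iff[OF \<open>0 < d\<close>] by blast
  then show thesis using that[of v] \<open>0 < d\<close> layer_Suc[of "parcs G" v "d - 1"] by auto
qed

lemma rgd_order_ge:
  assumes "rgd_graph 3 4 (5 + 4 * k + j) G" and "j \<le> 3"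
  shows "14 + 2 * j + 6 * k \<le> card (pverts G)"
proof -
  interpret cubic_triangle_free "pverts G" "parcs G"
    using assms(1) by (rule cubic_triangle_free_if_rgd)
  obtain v where "v \<in> pverts G" "layer (parcs G) v (5 + 4 * k + j) \<noteq> {}"
    using assms(1) by (rule rgd_endpoint) simp
  then show ?thesis using order_lower_bound assms(2) by blast
qed

text \<open>Each single-edge layer cut yields a bridge. Different cuts yield different bridges,
  because the outer end of the later one is beyond the ball that contains the earlier one.\<close>

lemma rgd_card_bridges_ge:
  assumes G: "rgd_graph 3 4 (5 + 4 * k + j) G"
    and order: "card (pverts G) \<le> 14 + 2 * j + 6 * k"
  shows "k \<le> card (bridges G)"
proof -
  interpret pair_graph G using G by (simp add: rgd_graph_def)
  interpret cubic_triangle_free "pverts G" "parcs G"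
    using G by (rule cubic_triangle_free_if_rgd)
  define d where "d = 5 + 4 * k + j"
  have "diameter G = ereal (real d)" "0 < d" using G by (simp_all add: rgd_graph_def d_def)
  then have "\<forall>u\<in>pverts G. \<forall>v\<in>pverts G. v \<in> ball (parcs G) u d"
    using diameter_eq_iff by blast
  then have conn: "u \<rightarrow>\<^sup>*\<^bsub>with_proj G\<^esub> v" if uv: "u \<in> pverts G" "v \<in> pverts G" for u v
  proof -
    from uv \<open>\<forall>u\<in>pverts G. \<forall>v\<in>pverts G. v \<in> ball (parcs G) u d\<close>
    obtain m where "(u, v) \<in> parcs G ^^ m" by (auto simp: ball_def)
    then show ?thesis
      using relpow_iff_awalk[OF uv(1)] reachable_awalk by metis
  qed
  obtain v where v: "v \<in> pverts G" and ne: "layer (parcs G) v d \<noteq> {}"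
    using G unfolding d_def by (rule rgd_endpoint) simp
  let ?K = "{i. i < d \<and> card (layer_cut v i) = 1}"
  have "\<forall>i\<in>?K. \<exists>a. layer_cut v i = {a}" by (auto simp: card_1_singleton_iff)
  then obtain a where a: "\<And>i. i \<in> ?K \<Longrightarrow> layer_cut v i = {a i}" by metis
  define e where "e i = {fst (a i), snd (a i)}" for i
  have e: "fst (a i) \<in> layer (parcs G) v i" "snd (a i) \<in> layer (parcs G) v (Suc i)" if "i \<in> ?K" for i
    using a[OF that] layer_cut_subset_layers[of v i] by auto
  have "e ` ?K \<subseteq> bridges G"
    using a bridge_if_single_arc_cut[OF conn] by (auto simp: layer_cut_def e_def)
  moreover have "inj_on e ?K"
  proof (rule linorder_inj_onI)
    fix i i' assume "i < i'" and i: "i \<in> ?K" "i' \<in> ?K"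
    have "e i \<subseteq> ball (parcs G) v (Suc i)"
      using e[OF i(1)] layer_subset_ball[of "parcs G" v] ball_mono[of i "Suc i" "parcs G" v]
      by (auto simp: e_def)
    also have "\<dots> \<subseteq> ball (parcs G) v i'" using \<open>i < i'\<close> by (intro ball_mono) simp
    finally show "e i \<noteq> e i'" using e(2)[OF i(2)] by (auto simp: e_def layer_Suc doubleton_eq_iff)
  qed auto
  ultimately have "card ?K \<le> card (bridges G)"
    using finite_bridges card_mono card_image by metis
  moreover have "k \<le> card ?K"
    using many_single_edge_cuts[OF v ne d_def order] .
  ultimately show ?thesis by simp
qed

section \<open>Graphs attaining the bound\<close>

lemma relpow_subset_mono: "(E :: 'a rel) \<subseteq> F \<Longrightarrow> E ^^ m \<subseteq> F ^^ m"
  by (induction m) (auto simp: relcomp_mono)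

lemma ball_mono_rel: "E \<subseteq> F \<Longrightarrow> ball E v i \<subseteq> ball F v i"
  using relpow_subset_mono[of E F] by (fastforce simp: ball_def)

text \<open>A potential that rises by at most one along every arc certifies lower bounds on
  distances.\<close>

lemma ball_lipschitz:
  assumes f: "\<And>x y. (x, y) \<in> E \<Longrightarrow> f y \<le> Suc (f x)" and "u \<in> ball E v i"
  shows "f u \<le> f v + i"
proof -
  have "f u \<le> f v + m" if "(v, u) \<in> E ^^ m" for m u
    using that
  proof (induction m arbitrary: u)
    case (Suc m)
    then show ?case using f by fastforce
  qed simp
  then show ?thesis using assms(2) by (fastforce simp: ball_def)
qed

section \<open>Joining rooted graphs by an edge\<close>

definition join :: "'a rel \<Rightarrow> 'a \<Rightarrow> 'a \<Rightarrow> 'a rel \<Rightarrow> 'a rel" where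
  "join E a b F = E \<union> F \<union> {(a, b), (b, a)}"

lemma join_commute: "join E a b F = join F b a E"
  by (auto simp: join_def)

lemma join_nbrs:
  assumes "E \<subseteq> V \<times> V" "F \<subseteq> W \<times> W" "V \<inter> W = {}" "b \<in> W" "u \<in> V"
  shows "join E a b F `` {u} = (if u = a then insert b (E `` {u}) else E `` {u})"
  using assms by (auto simp: join_def)

lemma card_join_nbrs:
  assumes "E \<subseteq> V \<times> V" "F \<subseteq> W \<times> W" "V \<inter> W = {}" "b \<in> W" "u \<in> V" "finite V"
  shows "card (join E a b F `` {u}) = (if u = a then Suc (card (E `` {u})) else card (E `` {u}))"
proof -
  have "finite (E `` {u})" by (rule finite_subset[OF _ \<open>finite V\<close>]) (use assms(1) in auto)
  moreover have "b \<notin> E `` {u}" using assms by auto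
  ultimately show ?thesis by (subst join_nbrs[OF assms(1-5)]) auto
qed

text \<open>The new edge is the only link between \<open>V\<close> and \<open>W\<close>, and a
  triangle through it would have to cross back by another edge.\<close>

lemma join_triangle_free:
  assumes "E \<subseteq> V \<times> V" "F \<subseteq> W \<times> W" "V \<inter> W = {}" "a \<in> V" "b \<in> W"
    and tri: "\<And>x y z. (x, y) \<in> E \<Longrightarrow> (y, z) \<in> E \<Longrightarrow> (x, z) \<notin> E"
      "\<And>x y z. (x, y) \<in> F \<Longrightarrow> (y, z) \<in> F \<Longrightarrow> (x, z) \<notin> F"
    and xyz: "(x, y) \<in> join E a b F" "(y, z) \<in> join E a b F"
  shows "(x, z) \<notin> join E a b F"
proof -
  have side: "x \<in> V \<and> y \<in> V \<and> (x, y) \<in> E \<or> x \<in> W \<and> y \<in> W \<and> (x, y) \<in> F \<or>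
      x = a \<and> y = b \<or> x = b \<and> y = a" if "(x, y) \<in> join E a b F" for x y
    using that assms(1,2) by (auto simp: join_def)
  have ends: "a \<notin> W" "b \<notin> V" "(a, a) \<notin> E" "(b, b) \<notin> F"
    using assms(3-5) tri(1)[of a a a] tri(2)[of b b b] by blast+
  have disj: "t \<in> V \<Longrightarrow> t \<notin> W" for t using assms(3) by blast
  show ?thesis
  proof
    assume "(x, z) \<in> join E a b F"
    from side[OF xyz(1)] side[OF xyz(2)] side[OF this] show False
      using ends assms(4,5) tri[of x y z] disj[of x] disj[of y] disj[of z]
      by (elim disjE conjE) simp_all
  qed
qed

text \<open>Only opposite vertices are required to differ; neighbours differ as soon as
  \<open>E\<close> has no loops.\<close>

definition has_4_cycle :: "'a rel \<Rightarrow> bool" where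
  "has_4_cycle E \<longleftrightarrow>
     (\<exists>a b c d. (a, b) \<in> E \<and> (b, c) \<in> E \<and> (c, d) \<in> E \<and> (d, a) \<in> E \<and> a \<noteq> c \<and> b \<noteq> d)"

lemma has_4_cycle_mono: "has_4_cycle E \<Longrightarrow> E \<subseteq> F \<Longrightarrow> has_4_cycle F"
  unfolding has_4_cycle_def by blast

text \<open>
  A cubic graph with a pendant half-edge at the root \<open>r\<close>. The function \<open>f\<close> is the distance to \<open>r\<close>
  and \<open>h\<close> its maximum.
\<close>

locale rooted_graph =
  fixes V :: "'a set" and r :: 'a and E :: "'a rel" and h :: nat and f :: "'a \<Rightarrow> nat"
  assumes finite_V: "finite V"
    and root: "r \<in> V"
    and E_subset: "E \<subseteq> V \<times> V"
    and sym_E: "sym E"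
    and triangle_free: "\<And>x y z. (x, y) \<in> E \<Longrightarrow> (y, z) \<in> E \<Longrightarrow> (x, z) \<notin> E"
    and degree: "\<And>u. u \<in> V \<Longrightarrow> card (E `` {u}) = (if u = r then 2 else 3)"
    and four_cycle: "has_4_cycle E"
    and level_root: "f r = 0"
    and level_le: "\<And>u. u \<in> V \<Longrightarrow> f u \<le> h"
    and level_pred: "\<And>u. u \<in> V \<Longrightarrow> u \<noteq> r \<Longrightarrow> \<exists>w\<in>V. (w, u) \<in> E \<and> f u = Suc (f w)"
    and level_lipschitz: "\<And>x y. (x, y) \<in> E \<Longrightarrow> f y \<le> Suc (f x)"
    and level_max: "\<exists>w\<in>V. f w = h"
begin

lemma in_ball_level: "u \<in> V \<Longrightarrow> u \<in> ball E r (f u)"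
proof (induction "f u" arbitrary: u rule: less_induct)
  case less
  show ?case
  proof (cases "u = r")
    case False
    then obtain w where "w \<in> V" "(w, u) \<in> E" "f u = Suc (f w)"
      using level_pred less.prems by blast
    then show ?thesis using less.hyps[of w] ball_step[of w E r "f w" u] by simp
  qed simp
qed

lemma in_ball_root: "u \<in> V \<Longrightarrow> u \<in> ball E r h"
  by (rule subsetD[OF ball_mono[OF level_le] in_ball_level])

lemma in_ball_double: "u \<in> V \<Longrightarrow> v \<in> V \<Longrightarrow> v \<in> ball E u (2 * h)"
  using ball_trans[of r E u h v h] in_ball_root[of v] in_ball_root[of u]
    ball_commute[OF sym_E, of r u] by (simp add: mult_2)

end

text \<open>The extreme distance is attained across the new edge, as \<open>h + 1 + h'\<close>. The
  bound \<open>2 <= h'\<close> brings \<open>h + 3\<close> below this for pairs in \<open>V\<close>,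
  and \<open>h' <= Suc h\<close> does so with \<open>2 * h'\<close> for pairs in
  \<open>V'\<close>.\<close>

lemma rgd_graph_join:
  fixes V :: "'a set"
  assumes G: "rooted_graph V r E h f" and G': "rooted_graph V' r' E' h' f'"
    and disj: "V \<inter> V' = {}"
    and diam: "\<And>u v. u \<in> V \<Longrightarrow> v \<in> V \<Longrightarrow> v \<in> ball E u (h + 3)"
    and h: "2 \<le> h'" "h' \<le> Suc h"
  shows "rgd_graph 3 4 (h + h' + 1) \<lparr>pverts = V \<union> V', parcs = join E r r' E'\<rparr>"
proof -
  interpret G: rooted_graph V r E h f by fact
  interpret G': rooted_graph V' r' E' h' f' by fact
  let ?J = "join E r r' E'"
  let ?H = "\<lparr>pverts = V \<union> V', parcs = ?J\<rparr>"
  have sub: "?J \<subseteq> (V \<union> V') \<times> (V \<union> V')"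
    using G.E_subset G'.E_subset G.root G'.root by (auto simp: join_def)
  have sym: "sym ?J"
    using G.sym_E G'.sym_E by (auto simp: join_def sym_def)
  have tri: "(x, z) \<notin> ?J" if "(x, y) \<in> ?J" "(y, z) \<in> ?J" for x y z
    using that G.triangle_free G'.triangle_free
    by (intro join_triangle_free[OF G.E_subset G'.E_subset disj G.root G'.root])
  interpret H: pair_graph ?H
  proof
    show "finite (pverts ?H)" using G.finite_V G'.finite_V by simp
    show "finite (parcs ?H)"
      using finite_subset[OF sub] G.finite_V G'.finite_V by simp
    show "fst e \<noteq> snd e" if "e \<in> parcs ?H" for e
      using that tri[of "fst e" "fst e" "fst e"] by (cases e) auto
    show "symmetric (with_proj ?H)"
      using sym by (simp add: symmetric_def)
  qed (use sub in auto)
  have "regular 3 ?H"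
    unfolding H.regular_iff
  proof
    fix u assume "u \<in> pverts ?H"
    then consider "u \<in> V" | "u \<in> V'" by auto
    then show "card (parcs ?H `` {u}) = 3"
    proof cases
      case 1
      then show ?thesis
        using card_join_nbrs[OF G.E_subset G'.E_subset disj G'.root 1 G.finite_V, of r] G.degree[OF 1]
        by auto
    next
      case 2
      have "V' \<inter> V = {}" using disj by blast
      then show ?thesis
        using card_join_nbrs[OF G'.E_subset G.E_subset _ G.root 2 G'.finite_V, of r'] G'.degree[OF 2]
        by (auto simp: join_commute[of E r r' E'])
    qed
  qed
  moreover have "girth ?H = 4"
  proof -
    have "has_4_cycle ?J"
      using G.four_cycle by (rule has_4_cycle_mono) (auto simp: join_def)
    then obtain a b c d where cyc: "(a, b) \<in> ?J" "(b, c) \<in> ?J" "(c, d) \<in> ?J" "(d, a) \<in> ?J"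
      "a \<noteq> c" "b \<noteq> d"
      unfolding has_4_cycle_def by blast
    have "\<And>x y z. (x, y) \<in> parcs ?H \<Longrightarrow> (y, z) \<in> parcs ?H \<Longrightarrow> (x, z) \<notin> parcs ?H"
      unfolding pair_pre_digraph.simps by (rule tri)
    from H.girth_eq_4[where a = a and b = b and c = c and d = d, OF this] cyc show ?thesis by simp
  qed
  moreover have "diameter ?H = ereal (real (h + h' + 1))"
  proof -
    have E: "ball E u i \<subseteq> ball ?J u i" and E': "ball E' u i \<subseteq> ball ?J u i" for u i
      by (rule ball_mono_rel; auto simp: join_def)+
    have "v \<in> ball ?J u (h + h' + 1)" if "u \<in> V" "v \<in> V" for u v
      using diam[OF that] E ball_mono[of "h + 3" "h + h' + 1" ?J u] h by auto
    moreover have "v \<in> ball ?J u (h + h' + 1)" if "u \<in> V'" "v \<in> V'" for u v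
      using G'.in_ball_double[OF that] E' ball_mono[of "2 * h'" "h + h' + 1" ?J u] h by auto
    moreover have across: "v \<in> ball ?J u (h + h' + 1)" if "u \<in> V" "v \<in> V'" for u v
    proof -
      have "r \<in> ball E u h" using G.in_ball_root[OF that(1)] ball_commute[OF G.sym_E] by metis
      then have "r' \<in> ball ?J u (Suc h)"
        using E ball_step[of r ?J u h r'] by (auto simp: join_def)
      then have "v \<in> ball ?J u (Suc h + h')"
        by (rule ball_trans) (rule subsetD[OF E' G'.in_ball_root[OF that(2)]])
      then show ?thesis by simp
    qed
    moreover have "v \<in> ball ?J u (h + h' + 1)" if "u \<in> V'" "v \<in> V" for u v
      using across[OF that(2,1)] ball_commute[OF sym] by blast
    moreover have "\<exists>u\<in>V. \<exists>v\<in>V'. v \<notin> ball ?J u (h + h')"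
    proof -
      obtain u v where uv: "u \<in> V" "f u = h" "v \<in> V'" "f' v = h'"
        using G.level_max G'.level_max by blast
      \<comment> \<open>\<open>g\<close> is the position on the way from the deepest level of
        \<open>V\<close> down to \<open>r\<close>, over the joining edge (the \<open>Suc\<close>),
        and up into \<open>V'\<close>. It is 0 at \<open>u\<close> and \<open>h + h' + 1\<close> at
        \<open>v\<close>, so \<open>ball_lipschitz\<close> keeps them apart.\<close>
      define g where "g x = (if x \<in> V then h - f x else Suc (h + f' x))" for x
      have "g y \<le> Suc (g x)" if xy: "(x, y) \<in> ?J" for x y
      proof -
        consider "(x, y) \<in> E" | "(x, y) \<in> E'" | "x = r" "y = r'" | "x = r'" "y = r"
          using xy by (auto simp: join_def)
        then show ?thesis
        proof cases
          case 1
          \<comment> \<open>On \<open>V\<close> the potential falls as \<open>f\<close> rises, so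
            the level bound is needed for the reversed arc.\<close>
          then have "x \<in> V" "y \<in> V" "f x \<le> Suc (f y)"
            using G.E_subset G.level_lipschitz G.sym_E by (auto dest: symD)
          then show ?thesis by (simp add: g_def)
        next
          case 2
          then have "x \<notin> V" "y \<notin> V" "f' y \<le> Suc (f' x)"
            using G'.E_subset G'.level_lipschitz disj by auto
          then show ?thesis by (simp add: g_def)
        next
          case 3
          then show ?thesis using G'.root disj G'.level_root G.level_root G.root by (auto simp: g_def)
        next
          case 4
          then show ?thesis using G'.root disj G'.level_root G.level_root G.root by (auto simp: g_def)
        qed
      qed
      then have "g v \<le> g u + (h + h')" if "v \<in> ball ?J u (h + h')"
        using ball_lipschitz that by metis
      moreover have "g u = 0" "g v = Suc (h + h')"
        using uv disj by (auto simp: g_def)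
      ultimately show ?thesis using uv by fastforce
    qed
    ultimately show ?thesis
      by (subst H.diameter_eq_iff) auto
  qed
  ultimately show ?thesis
    using H.pair_graph by (simp add: rgd_graph_def numeral_eq_enat)
qed

text \<open>
  The vertices \<open>n, \<dots>, n + 5\<close> form four levels of sizes 1, 2, 2, 1 with all edges between
  consecutive levels.
\<close>

definition block :: "nat \<Rightarrow> nat rel" where
  "block n = (let B = {(n, n + 1), (n, n + 2), (n + 1, n + 3), (n + 1, n + 4),
     (n + 2, n + 3), (n + 2, n + 4), (n + 3, n + 5), (n + 4, n + 5)} in B \<union> B\<inverse>)"

text \<open>Distance from \<open>n + i\<close> to \<open>n + 5\<close>, the vertex that becomes the
  new root.\<close>

definition block_level :: "nat \<Rightarrow> nat" where
  "block_level i = [3, 2, 2, 1, 1, 0] ! i"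

lemma block_nbrs:
  "block n `` {n} = {n + 1, n + 2}"
  "block n `` {n + 1} = {n, n + 3, n + 4}"
  "block n `` {n + 2} = {n, n + 3, n + 4}"
  "block n `` {n + 3} = {n + 1, n + 2, n + 5}"
  "block n `` {n + 4} = {n + 1, n + 2, n + 5}"
  "block n `` {n + 5} = {n + 3, n + 4}"
  by (auto simp: block_def Let_def)

text \<open>The old root is joined to \<open>n\<close>. Old levels grow by 4: the joining edge and
  the three steps through the block. The invariant \<open>h + 3\<close> on distances survives since
  old-to-new pairs need \<open>h + 1 + 3\<close> steps and pairs inside the block at most
  \<open>3 + 3\<close>.\<close>

lemma rooted_graph_extend:
  assumes G: "rooted_graph V r E h f" and fresh: "V \<subseteq> {..<n}"
    and diam: "\<And>u v. u \<in> V \<Longrightarrow> v \<in> V \<Longrightarrow> v \<in> ball E u (h + 3)"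
  defines "W \<equiv> {n..<n + 6}"
  defines "F \<equiv> join E r n (block n)"
  defines "g \<equiv> (\<lambda>u. if u < n then f u + 4 else block_level (u - n))"
  shows "rooted_graph (V \<union> W) (n + 5) F (h + 4) g"
    and "\<And>u v. u \<in> V \<union> W \<Longrightarrow> v \<in> V \<union> W \<Longrightarrow> v \<in> ball F u (h + 4 + 3)"
proof -
  interpret G: rooted_graph V r E h f by fact
  have W: "W = {n, n + 1, n + 2, n + 3, n + 4, n + 5}" unfolding W_def by auto
  have B: "block n \<subseteq> W \<times> W" by (auto simp: block_def Let_def W_def)
  have disj: "V \<inter> W = {}" and disj': "W \<inter> V = {}" using fresh by (auto simp: W_def)
  have rn: "r < n" using fresh G.root by auto
  have nW: "n \<in> W" by (simp add: W)
  have symF: "sym F"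
    using G.sym_E by (auto simp: F_def join_def sym_def block_def Let_def)
  have block_edges: "(n, n + 1) \<in> F" "(n, n + 2) \<in> F" "(n + 1, n + 3) \<in> F"
    "(n + 1, n + 4) \<in> F" "(n + 3, n + 5) \<in> F" "(r, n) \<in> F"
    by (auto simp: F_def join_def block_def Let_def)
  have back_edges: "(n, r) \<in> F" "(n + 1, n) \<in> F" "(n + 3, n + 1) \<in> F" "(n + 3, n + 2) \<in> F"
    "(n + 5, n + 3) \<in> F" "(n + 5, n + 4) \<in> F"
    by (auto simp: F_def join_def block_def Let_def)
  \<comment> \<open>The parity of the level two-colours the block, so it has no triangle.\<close>
  have bipartite: "even (block_level (x - n)) \<noteq> even (block_level (y - n))" if "(x, y) \<in> block n" for x y
    using that by (auto simp: block_def Let_def block_level_def)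
  have block_triangle_free: "(x, z) \<notin> block n" if "(x, y) \<in> block n" "(y, z) \<in> block n" for x y z
    using bipartite[OF that(1)] bipartite[OF that(2)] bipartite[of x z] by blast
  have block_lip: "block_level (y - n) \<le> Suc (block_level (x - n))" if "(x, y) \<in> block n" for x y
    using that by (auto simp: block_def Let_def block_level_def)
  show "rooted_graph (V \<union> W) (n + 5) F (h + 4) g"
  proof
    show "finite (V \<union> W)" using G.finite_V by (simp add: W_def)
    show "n + 5 \<in> V \<union> W" by (simp add: W)
    show "F \<subseteq> (V \<union> W) \<times> (V \<union> W)"
      using G.E_subset B G.root nW by (auto simp: F_def join_def)
    show "sym F" by (rule symF)
    show "(x, z) \<notin> F" if "(x, y) \<in> F" "(y, z) \<in> F" for x y z
      unfolding F_def
      by (rule join_triangle_free[OF G.E_subset B disj G.root nW _ _ that[unfolded F_def]])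
        (erule (1) G.triangle_free, erule (1) block_triangle_free)
    show "card (F `` {u}) = (if u = n + 5 then 2 else 3)" if u: "u \<in> V \<union> W" for u
    proof (cases "u \<in> V")
      case True
      then show ?thesis
        using card_join_nbrs[OF G.E_subset B disj nW True G.finite_V, of r] G.degree fresh
        by (auto simp: F_def)
    next
      case False
      then have uW: "u \<in> W" using u by blast
      have "card (F `` {u}) = (if u = n then Suc (card (block n `` {u})) else card (block n `` {u}))"
        unfolding F_def join_commute[of E r]
        by (intro card_join_nbrs[OF B G.E_subset disj' G.root uW]) (simp add: W)
      with uW show ?thesis unfolding W
        by (elim insertE emptyE) (simp_all only: block_nbrs, simp_all)
    qed
    show "has_4_cycle F"
      using G.four_cycle by (rule has_4_cycle_mono) (auto simp: F_def join_def)
    show "g (n + 5) = 0" by (simp add: g_def block_level_def)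
    show "g u \<le> h + 4" if "u \<in> V \<union> W" for u
      using that G.level_le fresh unfolding W by (auto simp: g_def block_level_def)
    show "\<exists>w\<in>V \<union> W. (w, u) \<in> F \<and> g u = Suc (g w)" if u: "u \<in> V \<union> W" "u \<noteq> n + 5" for u
    proof (cases "u \<in> V")
      case True
      show ?thesis
      proof (cases "u = r")
        case True
        \<comment> \<open>The old root now has level 4 and descends to \<open>n\<close>, of level
          3.\<close>
        then show ?thesis
          using nW back_edges rn G.level_root
          by (intro bexI[of _ n]) (auto simp: g_def block_level_def)
      next
        case False
        then obtain w where "w \<in> V" "(w, u) \<in> E" "f u = Suc (f w)"
          using G.level_pred True by blast
        then show ?thesis
          using fresh True by (intro bexI[of _ w]) (auto simp: g_def F_def join_def)
      qed
    next
      case False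
      then have "u \<in> {n, n + 1, n + 2, n + 3, n + 4}" using u unfolding W by blast
      then consider "u = n" | "u = n + 1 \<or> u = n + 2" | "u = n + 3 \<or> u = n + 4" by blast
      then show ?thesis
      proof cases
        case 1
        then show ?thesis using back_edges
          by (intro bexI[of _ "n + 1"]) (auto simp: W g_def block_level_def)
      next
        case 2
        then show ?thesis using back_edges
          by (intro bexI[of _ "n + 3"]) (auto simp: W g_def block_level_def)
      next
        case 3
        then show ?thesis using back_edges
          by (intro bexI[of _ "n + 5"]) (auto simp: W g_def block_level_def)
      qed
    qed
    show "g y \<le> Suc (g x)" if xy: "(x, y) \<in> F" for x y
    proof -
      consider "(x, y) \<in> E" | "(x, y) \<in> block n" | "x = r" "y = n" | "x = n" "y = r"
        using xy by (auto simp: F_def join_def)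
      then show ?thesis
      proof cases
        case 1
        then have "x \<in> V" "y \<in> V" using G.E_subset by auto
        then have "x < n" "y < n" using fresh by auto
        then show ?thesis using G.level_lipschitz[OF 1] by (simp add: g_def)
      next
        case 2
        then have "x \<in> W" "y \<in> W" using B by auto
        then show ?thesis using block_lip[OF 2] by (simp add: g_def W_def)
      qed (use rn G.level_root in \<open>auto simp: g_def block_level_def\<close>)
    qed
    obtain w where "w \<in> V" "f w = h" using G.level_max by blast
    then show "\<exists>w\<in>V \<union> W. g w = h + 4" using fresh by (intro bexI[of _ w]) (auto simp: g_def)
  qed
  have E: "ball E u i \<subseteq> ball F u i" for u i
    by (intro ball_mono_rel) (auto simp: F_def join_def)
  have new: "w \<in> ball F n 3" if "w \<in> W" for w
  proof -
    have 1: "n + 1 \<in> ball F n 1" "n + 2 \<in> ball F n 1"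
      using ball_step[of n F n 0] block_edges by auto
    have 2: "n + 3 \<in> ball F n 2" "n + 4 \<in> ball F n 2"
      using ball_step[OF 1(1)] block_edges by (auto simp: numeral_2_eq_2)
    have 3: "n + 5 \<in> ball F n 3"
      using ball_step[OF 2(1)] block_edges by (auto simp: numeral_3_eq_3 numeral_2_eq_2)
    show ?thesis
      using that 1 2 3 ball_mono[of 1 3 F n] ball_mono[of 2 3 F n] unfolding W by auto
  qed
  have old: "n \<in> ball F u (h + 1)" if "u \<in> V" for u
  proof -
    have "r \<in> ball E u h" using G.in_ball_root[OF that] ball_commute[OF G.sym_E] by metis
    then show ?thesis using E ball_step[of r F u h n] block_edges by auto
  qed
  have across: "w \<in> ball F u (h + 4 + 3)" if "u \<in> V" "w \<in> W" for u w
    using ball_trans[OF old[OF that(1)] new[OF that(2)]] ball_mono[of "h + 1 + 3" "h + 4 + 3" F u] by auto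
  fix u v assume "u \<in> V \<union> W" "v \<in> V \<union> W"
  then consider "u \<in> V" "v \<in> V" | "u \<in> V" "v \<in> W" | "v \<in> V" "u \<in> W" | "u \<in> W" "v \<in> W"
    by blast
  then show "v \<in> ball F u (h + 4 + 3)"
  proof cases
    case 1
    then show ?thesis using diam[OF 1] E ball_mono[of "h + 3" "h + 4 + 3" F u] by auto
  next
    case 2
    then show ?thesis by (rule across)
  next
    case 3
    then show ?thesis using across ball_commute[OF symF] by blast
  next
    case 4
    have "n \<in> ball F u 3" using new[OF 4(1)] ball_commute[OF symF] by blast
    from ball_trans[OF this new[OF 4(2)]] show ?thesis
      using ball_mono[of "3 + 3" "h + 4 + 3" F u] by auto
  qed
qed

text \<open>The lower bound \<open>m\<close> on the vertex numbers is carried along to keep the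
  growing chain disjoint from a cap placed below \<open>m\<close>.\<close>

lemma rooted_graph_extend_iterated:
  fixes V :: "nat set"
  assumes "rooted_graph V r E h f"
    and "\<And>u v. u \<in> V \<Longrightarrow> v \<in> V \<Longrightarrow> v \<in> ball E u (h + 3)"
    and "\<And>u. u \<in> V \<Longrightarrow> m \<le> u"
  shows "\<exists>V' r' E' f'. rooted_graph V' r' E' (h + 4 * k) f' \<and>
    (\<forall>u\<in>V'. \<forall>v\<in>V'. v \<in> ball E' u (h + 4 * k + 3)) \<and>
    (\<forall>u\<in>V'. m \<le> u) \<and> card V' = card V + 6 * k"
proof (induction k)
  case 0
  show ?case
    using assms by (intro exI[of _ V] exI[of _ r] exI[of _ E] exI[of _ f]) auto
next
  case (Suc k)
  then obtain V' r' E' f' where G: "rooted_graph V' r' E' (h + 4 * k) f'"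
    and diam: "\<And>u v. u \<in> V' \<Longrightarrow> v \<in> V' \<Longrightarrow> v \<in> ball E' u (h + 4 * k + 3)"
    and m: "\<forall>u\<in>V'. m \<le> u" and card: "card V' = card V + 6 * k"
    by blast
  interpret G: rooted_graph V' r' E' "h + 4 * k" f' by fact
  define n where "n = Suc (Max V')"
  have fresh: "V' \<subseteq> {..<n}" using G.finite_V by (auto simp: n_def less_Suc_eq_le)
  have mn: "m \<le> n" using G.root m fresh by fastforce
  have "V' \<inter> {n..<n + 6} = {}" using fresh by auto
  then have "card (V' \<union> {n..<n + 6}) = card V + 6 * Suc k"
    using card G.finite_V by (subst card_Un_disjoint) auto
  moreover have "\<forall>u\<in>V' \<union> {n..<n + 6}. m \<le> u" using m mn by auto
  moreover have h: "h + 4 * k + 4 = h + 4 * Suc k" by simp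
  note rooted_graph_extend[OF G fresh diam, unfolded h]
  ultimately show ?case by blast
qed

section \<open>Caps verified by evaluation\<close>

definition nbr_list :: "('a \<times> 'a) list \<Rightarrow> 'a \<Rightarrow> 'a list" where
  "nbr_list es u = map snd (filter (\<lambda>e. fst e = u) es)"

lemma set_nbr_list: "set (nbr_list es u) = set es `` {u}"
  by (force simp: nbr_list_def)

text \<open>All quantifiers range over lists, so that the axioms of \<open>rooted_graph\<close> can
  be evaluated. The 4-cycle is left out and supplied by explicit vertices.\<close>

definition rooted_list :: "nat list \<Rightarrow> nat \<Rightarrow> (nat \<times> nat) list \<Rightarrow> nat \<Rightarrow> (nat \<Rightarrow> nat) \<Rightarrow> bool" where
  "rooted_list vs r es h f \<longleftrightarrow>
     (\<forall>e\<in>set es. fst e \<in> set vs \<and> snd e \<in> set vs \<and> (snd e, fst e) \<in> set es \<and>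
        f (snd e) \<le> Suc (f (fst e)) \<and>
        (\<forall>z\<in>set (nbr_list es (snd e)). (fst e, z) \<notin> set es)) \<and>
     (\<forall>u\<in>set vs. length (remdups (nbr_list es u)) = (if u = r then 2 else 3) \<and> f u \<le> h \<and>
        (u \<noteq> r \<longrightarrow> (\<exists>w\<in>set vs. (w, u) \<in> set es \<and> f u = Suc (f w)))) \<and>
     r \<in> set vs \<and> f r = 0 \<and> (\<exists>w\<in>set vs. f w = h)"

lemma rooted_graph_if_list:
  assumes "rooted_list vs r es h f" and "has_4_cycle (set es)"
  shows "rooted_graph (set vs) r (set es) h f"
proof
  have edge: "x \<in> set vs \<and> y \<in> set vs \<and> (y, x) \<in> set es \<and> f y \<le> Suc (f x)"
    if "(x, y) \<in> set es" for x y
    using assms(1) that unfolding rooted_list_def by fastforce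
  show "set es \<subseteq> set vs \<times> set vs" "sym (set es)"
    and "\<And>x y. (x, y) \<in> set es \<Longrightarrow> f y \<le> Suc (f x)"
    using edge by (auto simp: sym_def)
  show "(x, z) \<notin> set es" if "(x, y) \<in> set es" "(y, z) \<in> set es" for x y z
    using assms(1) that unfolding rooted_list_def by (fastforce simp: set_nbr_list)
  show "card (set es `` {u}) = (if u = r then 2 else 3)" if "u \<in> set vs" for u
    using assms(1) that unfolding rooted_list_def
    by (auto simp: set_nbr_list[symmetric] card_set)
qed (use assms in \<open>auto simp: rooted_list_def\<close>)

text \<open>
  The shift \<open>s\<close> moves one of the two caps to the vertices from 11 on, so that the chain of blocks can
  grow upwards from it without meeting the other cap.
\<close>

definition both_ways :: "nat \<Rightarrow> (nat \<times> nat) list \<Rightarrow> (nat \<times> nat) list" where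
  "both_ways s es = concat (map (\<lambda>(x, y). [(s + x, s + y), (s + y, s + x)]) es)"

text \<open>Each edge is listed once. This cap has root 6 and depth 2; the two caps after it have
  root 0 and depths 3 and 4.\<close>

definition cap7 :: "(nat \<times> nat) list" where
  "cap7 = [(0, 1), (0, 2), (0, 3), (1, 4), (1, 5), (2, 4), (2, 5), (3, 4), (3, 6), (5, 6)]"

definition cap9 :: "(nat \<times> nat) list" where
  "cap9 = [(0, 1), (0, 2), (1, 3), (1, 4), (2, 5), (2, 6), (3, 5), (3, 7), (4, 7), (4, 8),
     (6, 7), (6, 8), (5, 8)]"

text \<open>Vertices 5 to 10 form the complete bipartite graph on 3 + 3 vertices minus the edge
  between 5 and 6; these two are linked to the square 1, 3, 2, 4 below the root.\<close>

definition cap11 :: "(nat \<times> nat) list" where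
  "cap11 = [(0, 1), (0, 2), (1, 3), (1, 4), (2, 3), (2, 4), (3, 5), (4, 6),
     (5, 9), (5, 10), (7, 6), (7, 9), (7, 10), (8, 6), (8, 9), (8, 10)]"

lemma rooted_cap7: "s \<in> {0, 11} \<Longrightarrow>
  rooted_list [s..<s + 7] (s + 6) (both_ways s cap7) 2 (\<lambda>u. [2, 2, 2, 1, 2, 1, 0] ! (u - s))"
  \<comment> \<open>The two shifts are substituted first, so that evaluation meets closed
    terms.\<close>
  by (elim insertE emptyE; hypsubst; code_simp)

lemma rooted_cap9: "s \<in> {0, 11} \<Longrightarrow>
  rooted_list [s..<s + 9] s (both_ways s cap9) 3 (\<lambda>u. [0, 1, 1, 2, 2, 2, 2, 3, 3] ! (u - s))"
  by (elim insertE emptyE; hypsubst; code_simp)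

lemma rooted_cap11:
  "rooted_list [0..<11] 0 (both_ways 0 cap11) 4 (\<lambda>u. [0, 1, 1, 2, 2, 3, 3, 4, 4, 4, 4] ! u)"
  by code_simp

text \<open>The square is given as two vertices \<open>a\<close>, \<open>c\<close> with two common
  listed successors \<open>b\<close>, \<open>d\<close>; the reverse arcs close it.\<close>

lemma has_4_cycle_both_ways:
  assumes "(a, b) \<in> set es" "(a, d) \<in> set es" "(c, b) \<in> set es" "(c, d) \<in> set es"
    and "a \<noteq> c" "b \<noteq> d"
  shows "has_4_cycle (set (both_ways s es))"
  unfolding has_4_cycle_def both_ways_def
  by (rule exI[of _ "s + a"], rule exI[of _ "s + b"], rule exI[of _ "s + c"], rule exI[of _ "s + d"])
    (use assms in force)

lemma rooted_graph_caps:
  fixes s :: nat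
  assumes "s \<in> {0, 11}"
  shows "\<exists>r E f. rooted_graph {s..<s + 7} r E 2 f"
    and "\<exists>r E f. rooted_graph {s..<s + 9} r E 3 f"
proof -
  have "has_4_cycle (set (both_ways s cap7))"
    by (rule has_4_cycle_both_ways[of 1 4 _ 5 2]) (simp_all add: cap7_def)
  from rooted_graph_if_list[OF rooted_cap7[OF assms] this]
  show "\<exists>r E f. rooted_graph {s..<s + 7} r E 2 f" unfolding set_upt by blast
  have "has_4_cycle (set (both_ways s cap9))"
    by (rule has_4_cycle_both_ways[of 4 7 _ 8 6]) (simp_all add: cap9_def)
  from rooted_graph_if_list[OF rooted_cap9[OF assms] this]
  show "\<exists>r E f. rooted_graph {s..<s + 9} r E 3 f" unfolding set_upt by blast
qed

lemma rooted_graph_cap11: "\<exists>r E f. rooted_graph {0..<11::nat} r E 4 f"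
proof -
  have "has_4_cycle (set (both_ways 0 cap11))"
    by (rule has_4_cycle_both_ways[of 1 3 _ 4 2]) (simp_all add: cap11_def)
  from rooted_graph_if_list[OF rooted_cap11 this] show ?thesis unfolding set_upt by blast
qed

lemma rgd_graph_of_caps:
  fixes V V' :: "nat set"
  assumes G: "rooted_graph V r E h f" and G': "rooted_graph V' r' E' h' f'"
    and "\<And>u. u \<in> V \<Longrightarrow> m \<le> u" and "\<And>u. u \<in> V' \<Longrightarrow> u < m"
    and h: "h \<le> 3" "2 \<le> h'" "h' \<le> Suc h" and d: "d = h + 4 * k + h' + 1"
  shows "\<exists>H :: nat pair_pre_digraph. rgd_graph 3 4 d H \<and>
    card (pverts H) = card V + 6 * k + card V'"
proof -
  interpret G: rooted_graph V r E h f by fact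
  interpret G': rooted_graph V' r' E' h' f' by fact
  \<comment> \<open>A cap of depth at most 3 satisfies the invariant at the start, since
    \<open>2 * h <= h + 3\<close>.\<close>
  have "v \<in> ball E u (h + 3)" if "u \<in> V" "v \<in> V" for u v
    using G.in_ball_double[OF that] ball_mono[of "2 * h" "h + 3" E u] \<open>h \<le> 3\<close> by auto
  then obtain W s F g where K: "rooted_graph W s F (h + 4 * k) g"
    and diam: "\<And>u v. u \<in> W \<Longrightarrow> v \<in> W \<Longrightarrow> v \<in> ball F u (h + 4 * k + 3)"
    and m: "\<forall>u\<in>W. m \<le> u" and card: "card W = card V + 6 * k"
    using rooted_graph_extend_iterated[OF G _ assms(3), of k] by blast
  interpret K: rooted_graph W s F "h + 4 * k" g by fact
  have disj: "W \<inter> V' = {}" using m assms(4) by force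
  have "rgd_graph 3 4 d \<lparr>pverts = W \<union> V', parcs = join F s r' E'\<rparr>"
    using h unfolding d by (intro rgd_graph_join[OF K G' disj diam]) auto
  moreover have "card (W \<union> V') = card V + 6 * k + card V'"
    using card disj K.finite_V G'.finite_V by (subst card_Un_disjoint) auto
  ultimately show ?thesis
    by (intro exI[of _ "\<lparr>pverts = W \<union> V', parcs = join F s r' E'\<rparr>"]) simp
qed

text \<open>For \<open>j\<close> = 0, 1, 2, 3 the cap sizes are 7 + 7, 7 + 9, 9 + 9, 9 + 11, with
  depths 2 + 2, 2 + 3, 3 + 3, 3 + 4. The chain grows from the first cap, on vertices from 11 on,
  whose depth must not exceed 3; so the cap of depth 4 serves as the second.\<close>

lemma rgd_graph_exists:
  assumes "j \<le> 3"
  shows "\<exists>H :: nat pair_pre_digraph. rgd_graph 3 4 (5 + 4 * k + j) H \<and>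
    card (pverts H) = 14 + 2 * j + 6 * k"
proof -
  obtain r7 E7 f7 where r7: "rooted_graph {0..<7::nat} r7 E7 2 f7"
    using rooted_graph_caps(1)[of 0] by auto
  obtain r9 E9 f9 where r9: "rooted_graph {0..<9::nat} r9 E9 3 f9"
    using rooted_graph_caps(2)[of 0] by auto
  obtain r11 E11 f11 where r11: "rooted_graph {0..<11::nat} r11 E11 4 f11"
    using rooted_graph_cap11 by auto
  obtain l7 F7 g7 where l7: "rooted_graph {11..<18::nat} l7 F7 2 g7"
    using rooted_graph_caps(1)[of 11] by auto
  obtain l9 F9 g9 where l9: "rooted_graph {11..<20::nat} l9 F9 3 g9"
    using rooted_graph_caps(2)[of 11] by auto
  note J = rgd_graph_of_caps[where m = 11 and k = k and d = "5 + 4 * k + j"]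
  from \<open>j \<le> 3\<close> consider "j = 0" | "j = 1" | "j = 2" | "j = 3" by linarith
  then show ?thesis
  proof cases
    case 1 then show ?thesis using J[OF l7 r7] by simp
  next
    case 2 then show ?thesis using J[OF l7 r9] by simp
  next
    case 3 then show ?thesis using J[OF l9 r9] by simp
  next
    case 4 then show ?thesis using J[OF l9 r11] by simp
  qed
qed

theorem proposition6:
  fixes G :: "'a pair_pre_digraph" and d j k :: nat
  assumes "j \<le> 3"
    and "d = 5 + 4 * k + j"
    and "rgd_cage 3 4 d G"
  shows "k \<le> card (bridges G) \<and> card (pverts G) = 14 + 2 * j + 6 * k"
proof -
  have G: "rgd_graph 3 4 (5 + 4 * k + j) G"
    using assms by (simp add: rgd_cage_def)
  \<comment> \<open>The example has natural numbers as vertices, hence is one of the competitors in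
    \<open>rgd_cage\<close> and bounds the order of \<open>G\<close> from above.\<close>
  obtain H :: "nat pair_pre_digraph" where "rgd_graph 3 4 d H" "card (pverts H) = 14 + 2 * j + 6 * k"
    using rgd_graph_exists[OF assms(1)] assms(2) by blast
  then have "card (pverts G) \<le> 14 + 2 * j + 6 * k"
    using assms(3) by (auto simp: rgd_cage_def)
  then show ?thesis
    using rgd_card_bridges_ge[OF G] rgd_order_ge[OF G assms(1)] by simp
qed

end
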